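(* Let $n\ge1$. (1) Let $\alpha_0,\dots,\alpha_{n-1}\in\mathbb{C}$ and $B=H(\alpha_0,\alpha_1,\dots,\alpha_{n-1})\in M_n(\mathbb{C})$. Then $B\in LA(n)$ if and only if there exist $\beta,\omega\in\mathbb{C}$ such that $|\beta|=1$, $\omega^n=1$ and $\alpha_i=\beta\omega^i|\alpha_i|$ for $i=0,1,\dots,n-1$. In this case $\|B\|_{p,p}=\sum_{i=0}^{n-1}|\alpha_i|$ for every $p\in[1,\infty]$. (2) Let $\alpha_0,\dots,\alpha_{n-1}\in\mathbb{R}$ and $A=C(\alpha_0,\alpha_1,\dots,\alpha_{n-1})\in M_n(\mathbb{C})$. Then $$\|A\|_{2,2}=\max\Big\{\Big|\sum_{i=0}^{n-1}\alpha_i\omega^i\Big|:\omega\in\mathbb{C},\ \omega^n=1\Big\}$$ and $$\|A\|_{2,2}\le\|A\|_{p,p}\le\begin{cases}\big(\sum_{i=0}^{n-1}|\alpha_i|\big)^{(2-p)/p}\,\|A\|_{2,2}^{2(p-1)/p}, & p\in[1,2),\\ \big(\sum_{i=0}^{n-1}|\alpha_i|\big)^{(p-2)/p}\,\|A\|_{2,2}^{2/p}, & p\in[2,\infty].\end{cases}$$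
   Context: For $\xi=(x_1,\dots,x_n)\in\mathbb{C}^n$, $\|\xi\|_p=(\sum_{i=1}^n|x_i|^p)^{1/p}$ for $1\le p<\infty$ and $\|\xi\|_\infty=\max_i|x_i|$. For $A\in M_n(\mathbb{C})$, $\|A\|_{p,p}=\sup\{\|A\xi\|_p:\|\xi\|_p=1\}$. A matrix $A\in M_n(\mathbb{C})$ is called logarithmic affine, written $A\in LA(n)$, if $\|A\|_{p,p}=\|A\|_{1,1}^{1/p}\|A\|_{\infty,\infty}^{1-1/p}$ for every $p\in[1,\infty]$. Conventions: $1/\infty=0$, $0^0=1$, and for $p=\infty$ the exponents $(p-2)/p$ and $2/p$ are $1$ and $0$. Rows and columns are indexed here by $0,\dots,n-1$. The circulant matrix $C(\alpha_0,\dots,\alpha_{n-1})$ has $(i,j)$ entry $\alpha_k$ where $0\le k\le n-1$ and $k\equiv j-i \pmod n$. The Hankel-type matrix $H(\alpha_0,\dots,\alpha_{n-1})$ has $(i,j)$ entry $\alpha_k$ where $0\le k\le n-1$ and $k\equiv i+j\pmod n$. *)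

theory Defs
  imports Complex_Main "HOL-Library.Extended_Real" "Jordan_Normal_Form.Matrix"
begin

text \<open>Real powers with the convention \<open>0\<^sup>0 = 1\<close>; in the library, \<open>0 powr 0 = 0\<close>.\<close>

definition rpow :: "real \<Rightarrow> real \<Rightarrow> real" where
  "rpow x a = (if a = 0 then 1 else x powr a)"

text \<open>Exponents \<open>p\<close> range over the extended reals with \<open>1 \<le> p\<close>. The norms below are
  meant for dimension at least 1 (otherwise the \<open>Max\<close> and \<open>Sup\<close> are taken over empty sets).\<close>

definition lp_norm :: "ereal \<Rightarrow> complex vec \<Rightarrow> real" where
  "lp_norm p v =
     (if p = \<infinity> then Max ((\<lambda>i. cmod (v $ i)) ` {..<dim_vec v})
      else rpow (\<Sum>i<dim_vec v. rpow (cmod (v $ i)) (real_of_ereal p)) (1 / real_of_ereal p))"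

definition lp_opnorm :: "ereal \<Rightarrow> complex mat \<Rightarrow> real" where
  "lp_opnorm p A =
     Sup {lp_norm p (A *\<^sub>v v) | v. v \<in> carrier_vec (dim_col A) \<and> lp_norm p v = 1}"

text \<open>On extended reals \<open>1 / \<infinity> = 0\<close>.\<close>

definition LA :: "nat \<Rightarrow> complex mat set" where
  "LA n = {A \<in> carrier_mat n n. \<forall>p::ereal. 1 \<le> p \<longrightarrow>
     lp_opnorm p A = rpow (lp_opnorm 1 A) (real_of_ereal (1 / p))
                   * rpow (lp_opnorm \<infinity> A) (1 - real_of_ereal (1 / p))}"

text \<open>Only the values \<open>\<alpha> 0, \<dots>, \<alpha> (n - 1)\<close> enter the matrices of size \<open>n\<close>.\<close>

definition circulant_mat :: "nat \<Rightarrow> (nat \<Rightarrow> complex) \<Rightarrow> complex mat" where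
  "circulant_mat n \<alpha> = mat n n (\<lambda>(i, j). \<alpha> (nat ((int j - int i) mod int n)))"

definition hankel_mat :: "nat \<Rightarrow> (nat \<Rightarrow> complex) \<Rightarrow> complex mat" where
  "hankel_mat n \<alpha> = mat n n (\<lambda>(i, j). \<alpha> ((i + j) mod n))"

end

theory Submission
  imports Defs "HOL-Complex_Analysis.Conformal_Mappings"
begin

text \<open>Everything reduces to circulants with complex entries: the Hankel matrix is the circulant with
  its rows permuted, and permuting coordinates preserves every norm in question. Let \<open>S\<close> be the sum of
  the moduli \<open>\<bar>\<alpha>\<^sub>k\<bar>\<close>, and call \<open>\<Sum>\<^sub>k \<alpha>\<^sub>k w\<^sup>k\<close>, for \<open>w\<close> an \<open>n\<close>-th root of unity, the symbol at \<open>w\<close>.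

  The symbol at \<open>w\<close> is the eigenvalue of the eigenvector of powers of \<open>w\<close>, so each operator norm is at
  least the maximum \<open>L\<close> of its modulus (\<open>circulant_symbol_le_opnorm\<close>). The discrete Fourier transform and
  Parseval's identity show that \<open>L\<close> is the norm at exponent 2 (\<open>circulant_opnorm_2\<close>). At the exponents 1 and
  \<open>\<infinity>\<close> the norm is \<open>S\<close>, all rows and columns having the same absolute sum. The upper bounds at the
  other exponents are Riesz--Thorin interpolation between 1 and 2 (\<open>riesz_thorin_bilinear\<close>, which
  rests on the three lines theorem of Hadamard), or, above 2, the same for the transposed matrix.

  For the Hankel matrix, membership in \<open>LA n\<close> at exponent 2 says \<open>L = S\<close>. This is equality in the
  triangle inequality for some \<open>\<Sum>\<^sub>k \<alpha>\<^sub>k w\<^sup>k\<close>, which forces a common phase of its terms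
  (\<open>phase_condition_iff\<close>). Conversely a common phase gives \<open>L = S\<close>, and the bounds from
  below by \<open>L\<close> and from above by \<open>S\<close> pin all operator norms.\<close>

text \<open>The symbol \<open>$\<close> is reserved for the components of vectors of variable dimension.\<close>

unbundle no vec_syntax

section \<open>Interpolation of norms\<close>

lemma powr_le_succ_powr:
  fixes c s r :: real
  assumes "0 \<le> c" "0 \<le> s" "s \<le> r"
  shows "c powr s \<le> (1 + c) powr r"
proof -
  have "c powr s \<le> (1 + c) powr s" using assms by (intro powr_mono2) auto
  also have "\<dots> \<le> (1 + c) powr r" using assms by (intro powr_mono) auto
  finally show ?thesis .
qed

text \<open>Dividing \<open>f\<close> by the expected bound, which is itself the modulus of a zero-free exponential,
  reduces the claim to the bound 1. The maximum principle fails on an unbounded strip, so the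
  quotient is first damped by \<open>exp (e * (w\<^sup>2 - 1))\<close>, whose modulus is at most 1 on the strip and decays
  as \<open>\<bar>Im w\<bar>\<close> grows; a tall enough rectangle then has the bound 1 on its whole boundary, and
  \<open>e\<close> tends to 0 at the end.\<close>

lemma three_lines_pos:
  fixes f :: "complex \<Rightarrow> complex"
  assumes hol: "f holomorphic_on {z. 0 < Re z \<and> Re z < 1}"
    and cont: "continuous_on {z. 0 \<le> Re z \<and> Re z \<le> 1} f"
    and bdd: "\<And>z. 0 \<le> Re z \<Longrightarrow> Re z \<le> 1 \<Longrightarrow> cmod (f z) \<le> K"
    and left: "\<And>z. Re z = 0 \<Longrightarrow> cmod (f z) \<le> M0"
    and right: "\<And>z. Re z = 1 \<Longrightarrow> cmod (f z) \<le> M1"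
    and M: "0 < M0" "0 < M1"
    and z: "0 \<le> Re z" "Re z \<le> 1"
  shows "cmod (f z) \<le> M0 powr (1 - Re z) * M1 powr Re z"
proof -
  define g where "g e w = f w * of_real M0 powr (w - 1) * of_real M1 powr (- w)
                    * exp (of_real e * (w\<^sup>2 - 1))" for e :: real and w
  have norm_g: "cmod (g e w) = cmod (f w) * M0 powr (Re w - 1) * M1 powr (- Re w)
                  * exp (e * ((Re w)\<^sup>2 - (Im w)\<^sup>2 - 1))" for e w
    using M by (simp add: g_def norm_mult norm_powr_real_powr power2_eq_square)
  define C where "C = K * (1 + 1 / M0) * (1 + 1 / M1)"
  have K0: "0 \<le> K" using order_trans[OF norm_ge_zero bdd[of 0]] by simp
  have factor: "cmod (f w) * M0 powr (Re w - 1) * M1 powr (- Re w) \<le> C"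
    if w: "0 \<le> Re w" "Re w \<le> 1" for w
  proof -
    have "M0 powr (Re w - 1) = (1 / M0) powr (1 - Re w)"
      using M by (simp add: powr_divide powr_minus_divide [symmetric])
    also have "\<dots> \<le> (1 + 1 / M0) powr 1"
      using M w by (intro powr_le_succ_powr) auto
    finally have 1: "M0 powr (Re w - 1) \<le> 1 + 1 / M0" using M by simp
    have "M1 powr (- Re w) = (1 / M1) powr (Re w)"
      using M by (simp add: powr_divide powr_minus_divide)
    also have "\<dots> \<le> (1 + 1 / M1) powr 1"
      using M w by (intro powr_le_succ_powr) auto
    finally have 2: "M1 powr (- Re w) \<le> 1 + 1 / M1" using M by simp
    show ?thesis unfolding C_def
      using 1 2 bdd[OF w] K0 M by (intro mult_mono) auto
  qed
  have g_le_1: "cmod (g e z) \<le> 1" if e: "0 < e" for e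
  proof -
    define R where "R = \<bar>Im z\<bar> + 1 + C / e"
    have C0: "0 \<le> C" unfolding C_def using K0 M by simp
    have R1: "1 \<le> R" "\<bar>Im z\<bar> \<le> R" "C / e \<le> R" using C0 e by (auto simp: R_def)
    let ?S = "cbox (Complex 0 (- R)) (Complex 1 R)"
    have strip: "?S \<subseteq> {z. 0 \<le> Re z \<and> Re z \<le> 1}" by (auto simp: in_cbox_complex_iff)
    show ?thesis
    proof (rule maximum_modulus_frontier[where S = ?S and f = "g e"])
      have "f holomorphic_on interior ?S"
        by (rule holomorphic_on_subset[OF hol]) (auto simp: interior_cbox in_box_complex_iff)
      then show "g e holomorphic_on interior ?S"
        unfolding g_def by (intro holomorphic_intros)
      have "continuous_on ?S f" using cont strip by (rule continuous_on_subset)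
      moreover have "continuous_on ?S (\<lambda>w. of_real M0 powr (w - 1) * of_real M1 powr (- w)
                    * exp (of_real e * (w\<^sup>2 - 1)))"
        by (intro holomorphic_on_imp_continuous_on holomorphic_intros)
      ultimately have "continuous_on ?S (\<lambda>w. f w * (of_real M0 powr (w - 1) * of_real M1 powr (- w)
                    * exp (of_real e * (w\<^sup>2 - 1))))"
        by (rule continuous_on_mult)
      then show "continuous_on (closure ?S) (g e)"
        by (simp add: g_def [abs_def] mult.assoc)
      show "bounded ?S" by (rule bounded_cbox)
      show "z \<in> ?S" using z R1 by (auto simp: in_cbox_complex_iff)
    next
      fix w assume "w \<in> frontier ?S"
      then have w: "0 \<le> Re w" "Re w \<le> 1" "\<bar>Im w\<bar> \<le> R"
        and bd: "Re w = 0 \<or> Re w = 1 \<or> \<bar>Im w\<bar> = R"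
        by (auto simp: frontier_def interior_cbox in_box_complex_iff in_cbox_complex_iff)
      have sq: "(Re w)\<^sup>2 \<le> 1" using w by (simp add: power_le_one)
      have exp_le: "exp (e * ((Re w)\<^sup>2 - (Im w)\<^sup>2 - 1)) \<le> 1"
      proof -
        have "(Re w)\<^sup>2 - (Im w)\<^sup>2 - 1 \<le> 0"
          using sq zero_le_power2[of "Im w"] by linarith
        then show ?thesis using e by (simp add: mult_le_0_iff)
      qed
      consider "Re w = 0" | "Re w = 1" | "\<bar>Im w\<bar> = R" using bd by blast
      then show "cmod (g e w) \<le> 1"
      proof cases
        case 1
        have "cmod (f w) * M0 powr (Re w - 1) * M1 powr (- Re w) \<le> 1"
          using left[OF 1] M 1 by (simp add: powr_minus_divide)
        then show ?thesis unfolding norm_g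
          by (rule mult_le_one[OF _ _ exp_le]) simp
      next
        case 2
        have "cmod (f w) * M0 powr (Re w - 1) * M1 powr (- Re w) \<le> 1"
          using right[OF 2] M 2 by (simp add: powr_minus_divide)
        then show ?thesis unfolding norm_g
          by (rule mult_le_one[OF _ _ exp_le]) simp
      next
        case 3
        have "C \<le> e * R" using R1 e by (simp add: field_simps)
        also have "\<dots> \<le> e * R\<^sup>2" using R1 e by (simp add: power2_eq_square)
        also have "\<dots> \<le> exp (e * R\<^sup>2)" using exp_ge_add_one_self[of "e * R\<^sup>2"] by linarith
        finally have C_le: "C \<le> exp (e * R\<^sup>2)" .
        have "(Im w)\<^sup>2 = R\<^sup>2" using 3 by (metis power2_abs)
        then have "exp (e * ((Re w)\<^sup>2 - (Im w)\<^sup>2 - 1)) \<le> exp (- (e * R\<^sup>2))"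
          using sq e by (simp add: algebra_simps)
        then have "cmod (g e w) \<le> C * exp (- (e * R\<^sup>2))"
          unfolding norm_g using factor w C0 by (intro mult_mono) auto
        also have "\<dots> \<le> 1" using C_le by (simp add: exp_minus field_simps)
        finally show ?thesis .
      qed
    qed
  qed
  let ?a = "cmod (f z) * M0 powr (Re z - 1) * M1 powr (- Re z)"
  let ?c = "(Re z)\<^sup>2 - (Im z)\<^sup>2 - 1"
  have "((\<lambda>e. ?a * exp (e * ?c)) \<longlongrightarrow> ?a * exp (0 * ?c)) (at_right 0)"
    by (intro tendsto_intros)
  then have "?a * exp (0 * ?c) \<le> 1"
  proof (rule tendsto_upperbound)
    show "\<forall>\<^sub>F e in at_right 0. ?a * exp (e * ?c) \<le> 1"
      using eventually_at_right_less[of 0]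
      by eventually_elim (use g_le_1 in \<open>simp add: norm_g\<close>)
  qed simp
  then have "?a \<le> 1" by simp
  moreover have "M0 powr (Re z - 1) = 1 / M0 powr (1 - Re z)" "M1 powr (- Re z) = 1 / M1 powr Re z"
    by (simp_all add: powr_minus_divide [symmetric])
  ultimately show ?thesis
    using M by (simp add: field_simps)
qed

text \<open>A zero bound on a boundary line is reached as the limit of positive bounds. In the interior both
  exponents are positive, so the interpolated bound is continuous there.\<close>

lemma three_lines:
  fixes f :: "complex \<Rightarrow> complex"
  assumes hol: "f holomorphic_on {z. 0 < Re z \<and> Re z < 1}"
    and cont: "continuous_on {z. 0 \<le> Re z \<and> Re z \<le> 1} f"
    and bdd: "\<And>z. 0 \<le> Re z \<Longrightarrow> Re z \<le> 1 \<Longrightarrow> cmod (f z) \<le> K"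
    and left: "\<And>z. Re z = 0 \<Longrightarrow> cmod (f z) \<le> M0"
    and right: "\<And>z. Re z = 1 \<Longrightarrow> cmod (f z) \<le> M1"
    and z: "0 < Re z" "Re z < 1"
  shows "cmod (f z) \<le> M0 powr (1 - Re z) * M1 powr Re z"
proof -
  have M: "0 \<le> M0" "0 \<le> M1"
    using order_trans[OF norm_ge_zero left[of 0]] order_trans[OF norm_ge_zero right[of 1]] by simp_all
  have "((\<lambda>d. (M0 + d) powr (1 - Re z) * (M1 + d) powr Re z)
          \<longlongrightarrow> (M0 + 0) powr (1 - Re z) * (M1 + 0) powr Re z) (at_right 0)"
    using M z
    by (intro tendsto_mult tendsto_powr' tendsto_intros)
       (auto intro!: eventually_at_rightI[of 0 1])
  then have "cmod (f z) \<le> (M0 + 0) powr (1 - Re z) * (M1 + 0) powr Re z"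
  proof (rule tendsto_lowerbound)
    have "cmod (f z) \<le> (M0 + d) powr (1 - Re z) * (M1 + d) powr Re z" if "0 < d" for d
    proof (rule three_lines_pos[OF hol cont bdd])
      show "cmod (f w) \<le> M0 + d" if "Re w = 0" for w
        using left[OF that] \<open>0 < d\<close> by linarith
      show "cmod (f w) \<le> M1 + d" if "Re w = 1" for w
        using right[OF that] \<open>0 < d\<close> by linarith
    qed (use that M z in auto)
    then show "\<forall>\<^sub>F d in at_right 0. cmod (f z) \<le> (M0 + d) powr (1 - Re z) * (M1 + d) powr Re z"
      by (auto intro!: eventually_at_rightI[of 0 1])
  qed simp
  then show ?thesis by simp
qed

text \<open>The Riesz--Thorin theorem between the exponents 1 and 2, for a bilinear form. The vectors \<open>x\<close> and \<open>y\<close>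
  are put into analytic families: the signs \<open>sgn\<close> of their entries are kept, and the moduli are replaced by
  \<open>\<bar>x\<^sub>j\<bar> powr (p * (1 - z / 2))\<close> and \<open>\<bar>y\<^sub>i\<bar> powr (q * z / 2)\<close>. These exponents are chosen so that the
  original vectors appear at \<open>z = 2 / q\<close>, while the moduli are constant on vertical lines: for \<open>Re z = 0\<close> those of the second family are at most 1, and all other norms that enter the two
  hypotheses for \<open>Re z = 0\<close> and \<open>Re z = 1\<close> are powers of the sums in the conclusion. The three lines
  theorem does the rest.\<close>

lemma riesz_thorin_bilinear:
  fixes a :: "'i \<Rightarrow> 'j \<Rightarrow> complex" and M0 M1 p q :: real
  assumes fin: "finite I" "finite J"
    and p: "1 < p" "p < 2" and pq: "1 / p + 1 / q = 1"
    and M: "0 \<le> M0" "0 \<le> M1"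
    and B1: "\<And>x y. (\<And>i. i \<in> I \<Longrightarrow> cmod (y i) \<le> 1) \<Longrightarrow>
       cmod (\<Sum>i\<in>I. \<Sum>j\<in>J. a i j * x j * y i) \<le> M0 * (\<Sum>j\<in>J. cmod (x j))"
    and B2: "\<And>x y. cmod (\<Sum>i\<in>I. \<Sum>j\<in>J. a i j * x j * y i)
       \<le> M1 * sqrt (\<Sum>j\<in>J. (cmod (x j))\<^sup>2) * sqrt (\<Sum>i\<in>I. (cmod (y i))\<^sup>2)"
  shows "cmod (\<Sum>i\<in>I. \<Sum>j\<in>J. a i j * x j * y i)
    \<le> M0 powr (2 / p - 1) * M1 powr (2 / q) *
      ((\<Sum>j\<in>J. cmod (x j) powr p) powr (1 / p) * (\<Sum>i\<in>I. cmod (y i) powr q) powr (1 / q))"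
proof -
  have q: "1 / q = 1 - 1 / p" using pq by simp
  have q_pos: "q > 0"
  proof -
    have "0 < 1 / q" using p q by simp
    then show ?thesis by (simp only: zero_less_divide_1_iff)
  qed
  have q2: "0 < 2 / q" "2 / q < 1"
  proof -
    show "0 < 2 / q" using q_pos by simp
    have "2 / q = 2 * (1 / q)" by simp
    also have "\<dots> = 2 - 2 / p" unfolding q by simp
    also have "\<dots> < 1" using p by (simp add: field_simps)
    finally show "2 / q < 1" .
  qed
  define X where "X = (\<Sum>j\<in>J. cmod (x j) powr p)"
  define Y where "Y = (\<Sum>i\<in>I. cmod (y i) powr q)"
  have XY: "0 \<le> X" "0 \<le> Y" by (auto simp: X_def Y_def intro: sum_nonneg)
  define xz where "xz z j = sgn (x j) * of_real (cmod (x j)) powr (of_real p * (1 - z / 2))" for z j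
  define yz where "yz z i = sgn (y i) * of_real (cmod (y i)) powr (of_real q * (z / 2))" for z i
  define F where "F z = (\<Sum>i\<in>I. \<Sum>j\<in>J. a i j * xz z j * yz z i)" for z
  have norm_xz: "cmod (xz z j) = cmod (x j) powr (p * (1 - Re z / 2))" for z j
    by (cases "x j = 0") (simp_all add: xz_def norm_mult norm_sgn norm_powr_real_powr)
  have norm_yz: "cmod (yz z i) = (if y i = 0 then 0 else cmod (y i) powr (q * (Re z / 2)))" for z i
    by (simp add: yz_def norm_mult norm_sgn norm_powr_real_powr)
  let ?t = "of_real (2 / q) :: complex"
  have "1 - 2 / q / 2 = 1 / p" using q by simp
  then have "p * (1 - 2 / q / 2) = 1" "q * (2 / q / 2) = 1"
    using p q_pos by simp_all
  then have exps: "of_real p * (1 - ?t / 2) = 1" "of_real q * (?t / 2) = 1"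
    by (metis of_real_1 of_real_diff of_real_divide of_real_mult of_real_numeral)+
  have "xz ?t j = x j" for j
    unfolding xz_def exps by (simp add: powr_one' sgn_eq)
  moreover have "yz ?t i = y i" for i
    unfolding yz_def exps by (simp add: powr_one' sgn_eq)
  ultimately have Ft: "F ?t = (\<Sum>i\<in>I. \<Sum>j\<in>J. a i j * x j * y i)"
    by (simp add: F_def)
  have hol: "F holomorphic_on A" for A
    unfolding F_def xz_def yz_def by (intro holomorphic_intros) auto
  have "cmod (F ?t) \<le> (M0 * X) powr (1 - Re ?t) * (M1 * sqrt X * sqrt Y) powr Re ?t"
  proof (rule three_lines[OF hol holomorphic_on_imp_continuous_on[OF hol]])
    fix z assume z: "0 \<le> Re z" "Re z \<le> 1"
    \<comment> \<open>Some bound on the whole strip, of any size, suffices for the three lines theorem.\<close>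
    show "cmod (F z) \<le> (\<Sum>i\<in>I. \<Sum>j\<in>J. cmod (a i j) * (1 + cmod (x j)) powr p * (1 + cmod (y i)) powr q)"
      unfolding F_def
    proof (intro sum_norm_le)
      fix i j
      have 1: "cmod (xz z j) \<le> (1 + cmod (x j)) powr p"
        unfolding norm_xz using z p by (intro powr_le_succ_powr) auto
      have 2: "cmod (yz z i) \<le> (1 + cmod (y i)) powr q"
        unfolding norm_yz using z q_pos by (auto intro!: powr_le_succ_powr)
      show "cmod (a i j * xz z j * yz z i) \<le> cmod (a i j) * (1 + cmod (x j)) powr p * (1 + cmod (y i)) powr q"
        unfolding norm_mult using 1 2 by (intro mult_mono) auto
    qed
  next
    fix z assume z: "Re z = 0"
    have "cmod (F z) \<le> M0 * (\<Sum>j\<in>J. cmod (xz z j))"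
      unfolding F_def by (rule B1) (simp add: norm_yz z)
    then show "cmod (F z) \<le> M0 * X" by (simp add: norm_xz z X_def)
  next
    fix z assume z: "Re z = 1"
    have "(cmod (xz z j))\<^sup>2 = cmod (x j) powr p" for j
      by (simp add: norm_xz z power2_eq_square flip: powr_add)
    moreover have "(cmod (yz z i))\<^sup>2 = cmod (y i) powr q" for i
      by (simp add: norm_yz z power2_eq_square flip: powr_add)
    ultimately show "cmod (F z) \<le> M1 * sqrt X * sqrt Y"
      using B2[of "xz z" "yz z"] by (simp add: F_def X_def Y_def)
  qed (use q2 in auto)
  also have "\<dots> = M0 powr (1 - 2 / q) * M1 powr (2 / q) * (X powr (1 - 2 / q) * X powr (1 / q) * Y powr (1 / q))"
    using M XY by (simp add: powr_mult powr_half_sqrt [symmetric] powr_powr)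
  also have "1 - 2 / q = 2 / p - 1" using q by (simp add: field_simps)
  also have "X powr (2 / p - 1) * X powr (1 / q) = X powr (1 / p)"
    by (simp flip: powr_add add: q)
  finally show ?thesis unfolding Ft X_def Y_def by (simp add: mult.assoc)
qed

text \<open>The converse of Hoelder's inequality: testing against
  \<open>y\<^sub>i = cnj (sgn u\<^sub>i) * \<bar>u\<^sub>i\<bar> powr (p - 1)\<close> attains equality, since \<open>(p - 1) * q = p\<close>.\<close>

lemma powr_sum_le_by_duality:
  fixes u :: "'i \<Rightarrow> complex" and p q K :: real
  assumes p: "1 < p" and pq: "1 / p + 1 / q = 1" and K: "0 \<le> K"
    and bound: "\<And>y. cmod (\<Sum>i\<in>I. u i * y i) \<le> K * (\<Sum>i\<in>I. cmod (y i) powr q) powr (1 / q)"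
  shows "(\<Sum>i\<in>I. cmod (u i) powr p) powr (1 / p) \<le> K"
proof -
  have q: "1 / q = 1 - 1 / p" using pq by simp
  define U where "U = (\<Sum>i\<in>I. cmod (u i) powr p)"
  have U0: "0 \<le> U" by (auto simp: U_def intro: sum_nonneg)
  define y where "y i = cnj (sgn (u i)) * of_real (cmod (u i) powr (p - 1))" for i
  have "q \<noteq> 0" using pq p by (intro notI) simp
  then have pq': "(p - 1) * q = p" using pq p by (simp add: field_simps)
  have ny: "cmod (y i) powr q = cmod (u i) powr p" for i
    by (cases "u i = 0") (simp_all add: y_def norm_mult norm_sgn powr_powr pq')
  have "u i * y i = of_real (cmod (u i) powr p)" for i
  proof (cases "u i = 0")
    case False
    have "u i * cnj (sgn (u i)) = of_real (cmod (u i))"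
      using False by (simp add: sgn_eq complex_norm_square [symmetric] power2_eq_square)
    then have "u i * y i = of_real (cmod (u i) * cmod (u i) powr (p - 1))"
      by (simp add: y_def mult.assoc [symmetric])
    also have "cmod (u i) * cmod (u i) powr (p - 1) = cmod (u i) powr p"
      using False by (simp add: powr_diff)
    finally show ?thesis .
  qed (simp add: y_def)
  then have "(\<Sum>i\<in>I. u i * y i) = of_real U" by (simp add: U_def)
  then have "U \<le> K * U powr (1 / q)"
    using bound[of y] U0 by (simp add: ny U_def [symmetric])
  moreover have "U = U powr (1 / p) * U powr (1 / q)"
    using U0 by (simp flip: powr_add add: pq)
  ultimately have *: "U powr (1 / p) * U powr (1 / q) \<le> K * U powr (1 / q)" by simp
  show ?thesis
  proof (cases "U = 0")
    case True
    then show ?thesis using K by (simp add: U_def [symmetric])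
  next
    case False
    then show ?thesis using * U0 by (simp add: U_def [symmetric])
  qed
qed

text \<open>At the exponent 1 a form is controlled by the absolute column sums of its matrix.\<close>

lemma riesz_thorin_col_sums:
  fixes a :: "'i \<Rightarrow> 'j \<Rightarrow> complex" and S L p q :: real
  assumes fin: "finite I" "finite J"
    and p: "1 < p" "p < 2" and pq: "1 / p + 1 / q = 1"
    and SL: "0 \<le> S" "0 \<le> L"
    and cols: "\<And>j. j \<in> J \<Longrightarrow> (\<Sum>i\<in>I. cmod (a i j)) \<le> S"
    and l2: "\<And>x y. cmod (\<Sum>i\<in>I. \<Sum>j\<in>J. a i j * x j * y i)
       \<le> L * sqrt (\<Sum>j\<in>J. (cmod (x j))\<^sup>2) * sqrt (\<Sum>i\<in>I. (cmod (y i))\<^sup>2)"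
  shows "cmod (\<Sum>i\<in>I. \<Sum>j\<in>J. a i j * x j * y i)
    \<le> S powr (2 / p - 1) * L powr (2 / q) *
      ((\<Sum>j\<in>J. cmod (x j) powr p) powr (1 / p) * (\<Sum>i\<in>I. cmod (y i) powr q) powr (1 / q))"
proof (rule riesz_thorin_bilinear[OF fin p pq SL _ l2])
  fix x :: "'j \<Rightarrow> complex" and y :: "'i \<Rightarrow> complex"
  assume y: "\<And>i. i \<in> I \<Longrightarrow> cmod (y i) \<le> 1"
  have "cmod (\<Sum>i\<in>I. \<Sum>j\<in>J. a i j * x j * y i) \<le> (\<Sum>i\<in>I. \<Sum>j\<in>J. cmod (a i j) * cmod (x j))"
    using y by (intro sum_norm_le) (auto simp: norm_mult intro!: mult_left_le)
  also have "\<dots> = (\<Sum>j\<in>J. (\<Sum>i\<in>I. cmod (a i j)) * cmod (x j))"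
    by (subst sum.swap) (simp add: sum_distrib_right)
  also have "\<dots> \<le> (\<Sum>j\<in>J. S * cmod (x j))"
    using cols by (intro sum_mono mult_right_mono) auto
  finally show "cmod (\<Sum>i\<in>I. \<Sum>j\<in>J. a i j * x j * y i) \<le> S * (\<Sum>j\<in>J. cmod (x j))"
    by (simp add: sum_distrib_left)
qed

lemma col_sum_interpolation:
  fixes a :: "'i \<Rightarrow> 'j \<Rightarrow> complex" and S L p :: real
  assumes fin: "finite I" "finite J" and p: "1 < p" "p < 2"
    and SL: "0 \<le> S" "0 \<le> L"
    and cols: "\<And>j. j \<in> J \<Longrightarrow> (\<Sum>i\<in>I. cmod (a i j)) \<le> S"
    and l2: "\<And>x y. cmod (\<Sum>i\<in>I. \<Sum>j\<in>J. a i j * x j * y i)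
       \<le> L * sqrt (\<Sum>j\<in>J. (cmod (x j))\<^sup>2) * sqrt (\<Sum>i\<in>I. (cmod (y i))\<^sup>2)"
  shows "(\<Sum>i\<in>I. cmod (\<Sum>j\<in>J. a i j * x j) powr p) powr (1 / p)
    \<le> S powr ((2 - p) / p) * L powr (2 * (p - 1) / p) * (\<Sum>j\<in>J. cmod (x j) powr p) powr (1 / p)"
proof (rule powr_sum_le_by_duality)
  have pq: "1 / p + 1 / (p / (p - 1)) = 1" using p by (simp add: field_simps)
  have e: "2 / p - 1 = (2 - p) / p" "2 / (p / (p - 1)) = 2 * (p - 1) / p"
    using p by (simp_all add: field_simps)
  show "1 / p + 1 / (p / (p - 1)) = 1" by (fact pq)
  show "cmod (\<Sum>i\<in>I. (\<Sum>j\<in>J. a i j * x j) * y i)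
      \<le> S powr ((2 - p) / p) * L powr (2 * (p - 1) / p) * (\<Sum>j\<in>J. cmod (x j) powr p) powr (1 / p)
        * (\<Sum>i\<in>I. cmod (y i) powr (p / (p - 1))) powr (1 / (p / (p - 1)))" for y
    using riesz_thorin_col_sums[OF fin p pq SL cols l2, of x y, unfolded e]
    by (simp add: sum_distrib_right mult.assoc)
qed (use p in auto)

text \<open>Exponents above 2 come from those below 2 by transposition: the bilinear form is the same,
  with the roles of \<open>x\<close> and \<open>y\<close> exchanged and \<open>p\<close> replaced by its conjugate exponent.\<close>

lemma row_sum_interpolation:
  fixes a :: "'i \<Rightarrow> 'j \<Rightarrow> complex" and S L p :: real
  assumes fin: "finite I" "finite J" and p: "2 < p"
    and SL: "0 \<le> S" "0 \<le> L"
    and rows: "\<And>i. i \<in> I \<Longrightarrow> (\<Sum>j\<in>J. cmod (a i j)) \<le> S"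
    and l2: "\<And>x y. cmod (\<Sum>i\<in>I. \<Sum>j\<in>J. a i j * x j * y i)
       \<le> L * sqrt (\<Sum>j\<in>J. (cmod (x j))\<^sup>2) * sqrt (\<Sum>i\<in>I. (cmod (y i))\<^sup>2)"
  shows "(\<Sum>i\<in>I. cmod (\<Sum>j\<in>J. a i j * x j) powr p) powr (1 / p)
    \<le> S powr ((p - 2) / p) * L powr (2 / p) * (\<Sum>j\<in>J. cmod (x j) powr p) powr (1 / p)"
proof (rule powr_sum_le_by_duality)
  define q where "q = p / (p - 1)"
  have q: "1 < q" "q < 2" and qp: "1 / q + 1 / p = 1" and e: "2 / q - 1 = (p - 2) / p"
    using p by (simp_all add: q_def field_simps)
  have swap: "(\<Sum>j\<in>J. \<Sum>i\<in>I. a i j * y i * x j) = (\<Sum>i\<in>I. \<Sum>j\<in>J. a i j * x j * y i)" for x y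
    by (subst sum.swap) (simp add: mult_ac)
  have l2': "cmod (\<Sum>j\<in>J. \<Sum>i\<in>I. a i j * y i * x j)
       \<le> L * sqrt (\<Sum>i\<in>I. (cmod (y i))\<^sup>2) * sqrt (\<Sum>j\<in>J. (cmod (x j))\<^sup>2)" for x y
    unfolding swap using l2[of x y] by (simp only: mult_ac)
  show "1 / p + 1 / q = 1" using qp by simp
  show "cmod (\<Sum>i\<in>I. (\<Sum>j\<in>J. a i j * x j) * y i)
      \<le> S powr ((p - 2) / p) * L powr (2 / p) * (\<Sum>j\<in>J. cmod (x j) powr p) powr (1 / p)
        * (\<Sum>i\<in>I. cmod (y i) powr q) powr (1 / q)" for y
    using riesz_thorin_col_sums[OF fin(2,1) q qp SL rows l2', of y x, unfolded e swap]
    unfolding sum_distrib_right by (simp only: mult_ac)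
qed (use p in auto)

section \<open>Cyclic sums and the discrete Fourier transform\<close>

lemma power_mod_root_of_unity:
  fixes w :: "'a :: monoid_mult"
  assumes "w ^ n = 1"
  shows "w ^ (m mod n) = w ^ m"
proof -
  have "w ^ m = w ^ (n * (m div n) + m mod n)" by simp
  also have "\<dots> = w ^ (m mod n)" unfolding power_add power_mult by (simp add: assms)
  finally show ?thesis by simp
qed

definition cyc_diff :: "nat \<Rightarrow> nat \<Rightarrow> nat \<Rightarrow> nat" where
  "cyc_diff n i j = nat ((int j - int i) mod int n)"

lemma cyc_diff_less:
  assumes "0 < n"
  shows "cyc_diff n i j < n"
  using pos_mod_bound[of "int n" "int j - int i"] assms unfolding cyc_diff_def by linarith

lemma int_cyc_diff:
  assumes "0 < n"
  shows "int (cyc_diff n i j) = (int j - int i) mod int n"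
  using assms by (simp add: cyc_diff_def)

lemma add_cyc_diff_mod:
  assumes "0 < n"
  shows "(i + cyc_diff n i j) mod n = j mod n"
proof -
  have "int ((i + cyc_diff n i j) mod n) = (int i + (int j - int i) mod int n) mod int n"
    unfolding of_nat_mod of_nat_add int_cyc_diff[OF assms] ..
  also have "\<dots> = int (j mod n)" by (simp add: mod_add_right_eq of_nat_mod)
  finally show ?thesis by (simp only: of_nat_eq_iff)
qed

lemma cyc_diff_add_mod:
  assumes "k < n"
  shows "cyc_diff n i ((i + k) mod n) = k"
proof -
  have "(int ((i + k) mod n) - int i) mod int n = int (k mod n)"
    by (simp add: of_nat_mod mod_diff_left_eq)
  then show ?thesis using assms by (simp add: cyc_diff_def)
qed

lemma cyc_diff_cyc_diff:
  assumes "i < n"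
  shows "cyc_diff n (cyc_diff n i j) j = i"
proof -
  have "int (cyc_diff n (cyc_diff n i j) j) = int (i mod n)"
    unfolding int_cyc_diff[OF order_le_less_trans[OF le0 assms]] mod_diff_right_eq
    by (simp add: of_nat_mod)
  then show ?thesis using assms by simp
qed

lemma power_cyc_diff:
  fixes w :: "'a :: monoid_mult"
  assumes "0 < n" "w ^ n = 1"
  shows "w ^ i * w ^ cyc_diff n i j = w ^ j"
proof -
  have "w ^ i * w ^ cyc_diff n i j = w ^ ((i + cyc_diff n i j) mod n)"
    unfolding power_add[symmetric] power_mod_root_of_unity[OF assms(2)] ..
  also have "\<dots> = w ^ j"
    unfolding add_cyc_diff_mod[OF assms(1)] power_mod_root_of_unity[OF assms(2)] ..
  finally show ?thesis .
qed

lemma sum_cyc_diff_right: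
  assumes "0 < n"
  shows "(\<Sum>j<n. f (cyc_diff n i j)) = (\<Sum>k<n. f k)"
  by (rule sum.reindex_bij_witness[where i = "\<lambda>k. (i + k) mod n" and j = "cyc_diff n i"])
     (use assms in \<open>simp_all add: cyc_diff_less add_cyc_diff_mod cyc_diff_add_mod\<close>)

lemma sum_cyc_diff_left:
  assumes "0 < n"
  shows "(\<Sum>i<n. f (cyc_diff n i j)) = (\<Sum>k<n. f k)"
  by (rule sum.reindex_bij_witness[where i = "\<lambda>k. cyc_diff n k j" and j = "\<lambda>i. cyc_diff n i j"])
     (use assms in \<open>simp_all add: cyc_diff_less cyc_diff_cyc_diff\<close>)

lemma norm_root_of_unity:
  fixes w :: complex
  assumes "w ^ n = 1" "0 < n"
  shows "cmod w = 1"
  using power_eq_1_iff[OF assms(1)] assms(2) by simp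

text \<open>Multiplication by a root of unity \<open>z\<close> permutes the roots of unity and multiplies the sum by
  \<open>z ^ i * cnj z ^ j\<close>. If this factor were 1 for every \<open>z\<close>, all \<open>n\<close> roots of unity would be roots
  of \<open>z ^ d = 1\<close> with \<open>d = \<bar>i - j\<bar> < n\<close>, which has only \<open>d\<close> solutions.\<close>

lemma roots_of_unity_orthogonal:
  assumes ij: "i < n" "j < n"
  shows "(\<Sum>w | w ^ n = 1. w ^ i * cnj w ^ j) = (if i = j then of_nat n else (0 :: complex))"
proof -
  have n: "0 < n" using ij by simp
  have inv: "w * cnj w = 1" if "w ^ n = 1" for w :: complex
    using norm_root_of_unity[OF that n] by (simp add: complex_norm_square [symmetric])
  have inv_pow: "w ^ k * cnj w ^ k = 1" if "w ^ n = 1" for w :: complex and k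
    using inv[OF that] by (simp flip: power_mult_distrib)
  show ?thesis
  proof (cases "i = j")
    case True
    then show ?thesis using n by (simp add: inv_pow card_roots_unity_eq)
  next
    case False
    have "\<exists>z :: complex. z ^ n = 1 \<and> z ^ i \<noteq> z ^ j"
    proof (rule ccontr)
      assume neg: "\<not> ?thesis"
      define a b where "a = min i j" and "b = max i j"
      have ab: "a < b" "b < n" using False ij by (auto simp: a_def b_def)
      have "{z :: complex. z ^ n = 1} \<subseteq> {z. z ^ (b - a) = 1}"
      proof safe
        fix z :: complex assume z: "z ^ n = 1"
        then have "z ^ a = z ^ b" using neg by (metis a_def b_def max_def min_def)
        also have "z ^ b = z ^ a * z ^ (b - a)" using ab by (simp flip: power_add)
        finally have "z ^ a * z ^ (b - a) = z ^ a" ..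
        then show "z ^ (b - a) = 1" using inv_pow[OF z, of a] by (metis mult.assoc mult.commute mult_1)
      qed
      then have "card {z :: complex. z ^ n = 1} \<le> card {z :: complex. z ^ (b - a) = 1}"
        using ab by (intro card_mono finite_roots_unity) auto
      then show False using ab by (simp add: card_roots_unity_eq)
    qed
    then obtain z :: complex where z: "z ^ n = 1" "z ^ i \<noteq> z ^ j" by blast
    define s where "s = (\<Sum>w | w ^ n = 1. w ^ i * cnj w ^ j :: complex)"
    have "s = (\<Sum>w | w ^ n = 1. (z * w) ^ i * cnj (z * w) ^ j)"
      unfolding s_def
    proof (rule sum.reindex_bij_witness[where i = "\<lambda>w. z * w" and j = "\<lambda>w. cnj z * w"])
      fix w :: complex assume "w \<in> {w. w ^ n = 1}"
      then have w: "w ^ n = 1" by simp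
      have cz: "cnj z ^ n = 1" using z(1) by (simp flip: complex_cnj_power)
      show "z * w \<in> {w. w ^ n = 1}" "cnj z * w \<in> {w. w ^ n = 1}"
        using w z(1) cz by (simp_all add: power_mult_distrib)
      show eqs: "z * (cnj z * w) = w" "cnj z * (z * w) = w"
        using inv[OF z(1)] by (metis mult.assoc mult.commute mult_1)+
      show "(z * (cnj z * w)) ^ i * cnj (z * (cnj z * w)) ^ j = w ^ i * cnj w ^ j"
        unfolding eqs ..
    qed
    also have "\<dots> = (z ^ i * cnj z ^ j) * s"
      by (simp add: s_def sum_distrib_left power_mult_distrib mult_ac)
    finally have "s = 0 \<or> z ^ i * cnj z ^ j = 1" by auto
    moreover have "z ^ i * cnj z ^ j \<noteq> 1"
    proof
      assume "z ^ i * cnj z ^ j = 1"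
      then have "z ^ i * (z ^ j * cnj z ^ j) = z ^ j" by (simp add: mult_ac)
      then show False using z inv_pow[OF z(1)] by simp
    qed
    ultimately show ?thesis using False by (simp add: s_def)
  qed
qed

lemma parseval:
  fixes v :: "nat \<Rightarrow> complex"
  assumes n: "0 < n"
  shows "(\<Sum>w | w ^ n = 1. (cmod (\<Sum>i<n. v i * w ^ i))\<^sup>2) = n * (\<Sum>i<n. (cmod (v i))\<^sup>2)"
proof -
  have "complex_of_real (\<Sum>w | w ^ n = 1. (cmod (\<Sum>i<n. v i * w ^ i))\<^sup>2)
      = (\<Sum>w | w ^ n = 1. \<Sum>i<n. \<Sum>j<n. v i * cnj (v j) * (w ^ i * cnj w ^ j))"
  proof -
    have "complex_of_real ((cmod (\<Sum>i<n. v i * w ^ i))\<^sup>2)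
        = (\<Sum>i<n. \<Sum>j<n. v i * cnj (v j) * (w ^ i * cnj w ^ j))" for w
      unfolding complex_norm_square cnj_sum sum_product by (simp add: mult_ac)
    then show ?thesis by simp
  qed
  also have "\<dots> = (\<Sum>i<n. \<Sum>j<n. v i * cnj (v j) * (\<Sum>w | w ^ n = 1. w ^ i * cnj w ^ j))"
    by (subst sum.swap, rule sum.cong[OF refl], subst sum.swap) (simp add: sum_distrib_left)
  also have "\<dots> = (\<Sum>i<n. \<Sum>j<n. v i * cnj (v j) * (if i = j then of_nat n else 0))"
    by (intro sum.cong refl) (simp add: roots_of_unity_orthogonal)
  also have "\<dots> = (\<Sum>i<n. of_nat n * (v i * cnj (v i)))"
    by (intro sum.cong refl) (simp add: if_distrib [of "(*) _"] sum.delta mult_ac cong: if_cong)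
  also have "\<dots> = complex_of_real (n * (\<Sum>i<n. (cmod (v i))\<^sup>2))"
    by (simp add: sum_distrib_left flip: complex_norm_square)
  finally show ?thesis using of_real_eq_iff by blast
qed

text \<open>The discrete Fourier transform diagonalises a circulant: the transform of \<open>C v\<close> at \<open>w\<close> is the
  transform of \<open>v\<close> at \<open>w\<close> times the symbol at \<open>cnj w\<close>. Parseval's identity on both sides turns
  the bound on the symbol into a bound in the Euclidean norm.\<close>

lemma circulant_l2_bound:
  fixes \<alpha> v :: "nat \<Rightarrow> complex"
  assumes n: "0 < n"
    and L: "\<And>w. w ^ n = 1 \<Longrightarrow> cmod (\<Sum>k<n. \<alpha> k * w ^ k) \<le> L"
  shows "(\<Sum>i<n. (cmod (\<Sum>j<n. \<alpha> (cyc_diff n i j) * v j))\<^sup>2) \<le> L\<^sup>2 * (\<Sum>j<n. (cmod (v j))\<^sup>2)"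
proof -
  define u where "u i = (\<Sum>j<n. \<alpha> (cyc_diff n i j) * v j)" for i
  have mult: "(\<Sum>i<n. u i * w ^ i) = (\<Sum>k<n. \<alpha> k * cnj w ^ k) * (\<Sum>j<n. v j * w ^ j)"
    if w: "w ^ n = 1" for w
  proof -
    have "w ^ k * cnj w ^ k = 1" for k
      using norm_root_of_unity[OF w n]
      by (simp flip: power_mult_distrib add: complex_norm_square [symmetric])
    then have shift: "w ^ i = w ^ j * cnj w ^ cyc_diff n i j" for i j
      using power_cyc_diff[OF n w, of i j] by (metis mult.assoc mult.right_neutral)
    have "(\<Sum>i<n. u i * w ^ i) = (\<Sum>j<n. \<Sum>i<n. \<alpha> (cyc_diff n i j) * v j * w ^ i)"
      unfolding u_def sum_distrib_right by (rule sum.swap)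
    also have "\<dots> = (\<Sum>j<n. (\<Sum>i<n. \<alpha> (cyc_diff n i j) * cnj w ^ cyc_diff n i j) * (v j * w ^ j))"
      unfolding sum_distrib_right
    proof (intro sum.cong refl)
      fix i j
      show "\<alpha> (cyc_diff n i j) * v j * w ^ i
          = \<alpha> (cyc_diff n i j) * cnj w ^ cyc_diff n i j * (v j * w ^ j)"
        unfolding shift[of i j] by (simp add: mult_ac)
    qed
    also have "\<dots> = (\<Sum>j<n. (\<Sum>k<n. \<alpha> k * cnj w ^ k) * (v j * w ^ j))"
      using sum_cyc_diff_left[OF n, of "\<lambda>k. \<alpha> k * cnj w ^ k"] by simp
    finally show ?thesis by (simp add: sum_distrib_left)
  qed
  have "n * (\<Sum>i<n. (cmod (u i))\<^sup>2) = (\<Sum>w | w ^ n = 1. (cmod (\<Sum>i<n. u i * w ^ i))\<^sup>2)"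
    by (rule parseval[OF n, symmetric])
  also have "\<dots> \<le> (\<Sum>w | w ^ n = 1. L\<^sup>2 * (cmod (\<Sum>j<n. v j * w ^ j))\<^sup>2)"
  proof (rule sum_mono)
    fix w :: complex assume "w \<in> {w. w ^ n = 1}"
    then have w: "w ^ n = 1" by simp
    then have "cnj w ^ n = 1" by (simp flip: complex_cnj_power)
    then have "cmod (\<Sum>k<n. \<alpha> k * cnj w ^ k) \<le> L" by (rule L)
    then show "(cmod (\<Sum>i<n. u i * w ^ i))\<^sup>2 \<le> L\<^sup>2 * (cmod (\<Sum>j<n. v j * w ^ j))\<^sup>2"
      unfolding mult[OF w] norm_mult power_mult_distrib
      by (intro mult_right_mono power_mono) auto
  qed
  also have "\<dots> = L\<^sup>2 * (n * (\<Sum>j<n. (cmod (v j))\<^sup>2))"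
    by (simp add: parseval[OF n] flip: sum_distrib_left)
  finally show ?thesis using n by (simp add: u_def)
qed

lemma circulant_bilinear_l2_bound:
  fixes \<alpha> x y :: "nat \<Rightarrow> complex"
  assumes n: "0 < n"
    and L: "\<And>w. w ^ n = 1 \<Longrightarrow> cmod (\<Sum>k<n. \<alpha> k * w ^ k) \<le> L"
  shows "cmod (\<Sum>i<n. \<Sum>j<n. \<alpha> (cyc_diff n i j) * x j * y i)
     \<le> L * sqrt (\<Sum>j<n. (cmod (x j))\<^sup>2) * sqrt (\<Sum>i<n. (cmod (y i))\<^sup>2)"
proof -
  define u where "u i = (\<Sum>j<n. \<alpha> (cyc_diff n i j) * x j)" for i
  have "0 \<le> L" using order_trans[OF norm_ge_zero L[of 1]] by simp
  have "cmod (\<Sum>i<n. \<Sum>j<n. \<alpha> (cyc_diff n i j) * x j * y i) = cmod (\<Sum>i<n. u i * y i)"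
    by (simp add: u_def sum_distrib_right)
  also have "\<dots> \<le> (\<Sum>i<n. \<bar>cmod (u i)\<bar> * \<bar>cmod (y i)\<bar>)"
    by (intro sum_norm_le) (simp add: norm_mult)
  also have "\<dots> \<le> sqrt (\<Sum>i<n. (cmod (u i))\<^sup>2) * sqrt (\<Sum>i<n. (cmod (y i))\<^sup>2)"
    using L2_set_mult_ineq[of "\<lambda>i. cmod (u i)" "\<lambda>i. cmod (y i)" "{..<n}"] by (simp add: L2_set_def)
  also have "sqrt (\<Sum>i<n. (cmod (u i))\<^sup>2) \<le> sqrt (L\<^sup>2 * (\<Sum>j<n. (cmod (x j))\<^sup>2))"
    unfolding u_def by (intro real_sqrt_le_mono circulant_l2_bound n L)
  also have "\<dots> = L * sqrt (\<Sum>j<n. (cmod (x j))\<^sup>2)" using \<open>0 \<le> L\<close> by (simp add: real_sqrt_mult)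
  finally show ?thesis by (simp add: mult_right_mono sum_nonneg)
qed

text \<open>After rotating the sum to the positive real axis, the real parts of the terms already add up to
  the sum of the moduli, so each term is its own modulus.\<close>

lemma triangle_equality_phase:
  fixes a :: "'i \<Rightarrow> complex"
  assumes "finite I" and eq: "cmod (\<Sum>i\<in>I. a i) = (\<Sum>i\<in>I. cmod (a i))"
  obtains b where "cmod b = 1" "\<And>i. i \<in> I \<Longrightarrow> a i = b * of_real (cmod (a i))"
proof (cases "(\<Sum>i\<in>I. a i) = 0")
  case True
  then have "\<And>i. i \<in> I \<Longrightarrow> a i = 0"
    using eq \<open>finite I\<close> by (simp add: sum_nonneg_eq_0_iff)
  then show ?thesis by (intro that[of 1]) auto
next
  case False
  define z where "z = (\<Sum>i\<in>I. a i)"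
  define b where "b = sgn z"
  have b: "cmod b = 1" using False by (simp add: b_def z_def norm_sgn)
  then have bb: "b * cnj b = 1" by (simp add: complex_norm_square [symmetric])
  have "z = b * of_real (cmod z)" using False by (simp add: b_def z_def sgn_eq)
  then have "cnj b * z = of_real (cmod z)" using bb
    by (metis mult.assoc mult.commute mult_1)
  then have "Re (\<Sum>i\<in>I. cnj b * a i) = cmod z"
    by (simp only: z_def sum_distrib_left [symmetric] Re_complex_of_real)
  then have "(\<Sum>i\<in>I. Re (cnj b * a i)) = cmod z"
    by (simp only: Re_sum)
  then have "(\<Sum>i\<in>I. cmod (a i) - Re (cnj b * a i)) = 0"
    using eq by (simp add: sum_subtractf z_def)
  moreover have le: "0 \<le> cmod (a i) - Re (cnj b * a i)" for i
    using complex_Re_le_cmod[of "cnj b * a i"] b by (simp add: norm_mult)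
  ultimately have Re_eq: "\<And>i. i \<in> I \<Longrightarrow> Re (cnj b * a i) = cmod (cnj b * a i)"
    using \<open>finite I\<close> b by (simp add: sum_nonneg_eq_0_iff norm_mult)
  show ?thesis
  proof (rule that[OF b])
    fix i assume "i \<in> I"
    then have Re: "Re (cnj b * a i) = cmod (cnj b * a i)" by (rule Re_eq)
    have "Im (cnj b * a i) = 0" by (rule Im_eq_0) (simp only: Re abs_norm_cancel)
    then have "cnj b * a i = of_real (cmod (cnj b * a i))"
      using Re by (intro complex_eqI) (simp_all only: Re_complex_of_real Im_complex_of_real)
    then have "b * cnj b * a i = b * of_real (cmod (a i))"
      using b by (simp add: norm_mult mult.assoc)
    then show "a i = b * of_real (cmod (a i))" by (simp add: bb)
  qed
qed

section \<open>Norms of vectors and operators\<close>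

lemma rpow_nonzero: "a \<noteq> 0 \<Longrightarrow> rpow x a = x powr a"
  by (simp add: rpow_def)

lemma lp_norm_ereal:
  assumes "1 \<le> r"
  shows "lp_norm (ereal r) v = (\<Sum>i<dim_vec v. cmod (v $ i) powr r) powr (1 / r)"
  using assms by (simp add: lp_norm_def rpow_nonzero)

lemma lp_norm_infinity: "lp_norm \<infinity> v = Max ((\<lambda>i. cmod (v $ i)) ` {..<dim_vec v})"
  by (simp add: lp_norm_def)

lemma ereal_ge_1_cases:
  assumes "1 \<le> p"
  obtains "p = \<infinity>" | r where "p = ereal r" "1 \<le> r"
  using assms by (cases p) auto

text \<open>Permuting coordinates is an isometry for every exponent, which lets Hankel matrices be replaced
  by circulants.\<close>

lemma lp_norm_reindex:
  assumes \<pi>: "bij_betw \<pi> {..<dim_vec v} {..<dim_vec w}"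
    and eq: "\<And>i. i < dim_vec v \<Longrightarrow> v $ i = w $ \<pi> i"
  shows "lp_norm p v = lp_norm p w"
proof -
  have "(\<lambda>i. cmod (v $ i)) ` {..<dim_vec v} = (\<lambda>i. cmod (w $ i)) ` \<pi> ` {..<dim_vec v}"
    unfolding image_image using eq by (intro image_cong) auto
  moreover have "(\<Sum>i<dim_vec v. rpow (cmod (v $ i)) r) = (\<Sum>i<dim_vec w. rpow (cmod (w $ i)) r)" for r
    using eq by (subst sum.reindex_bij_betw[OF \<pi>, symmetric]) simp
  ultimately show ?thesis
    using \<pi> by (simp add: lp_norm_def bij_betw_imp_surj_on)
qed

lemma lp_norm_smult:
  assumes p: "1 \<le> p" and v: "0 < dim_vec v"
  shows "lp_norm p (c \<cdot>\<^sub>v v) = cmod c * lp_norm p v"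
  using p
proof (cases rule: ereal_ge_1_cases)
  case 1
  have "(\<lambda>i. cmod ((c \<cdot>\<^sub>v v) $ i)) ` {..<dim_vec v} = (\<lambda>x. cmod c * x) ` (\<lambda>i. cmod (v $ i)) ` {..<dim_vec v}"
    unfolding image_image by (intro image_cong) (auto simp: norm_mult)
  also have "Max \<dots> = cmod c * Max ((\<lambda>i. cmod (v $ i)) ` {..<dim_vec v})"
    using v by (intro mono_Max_commute [symmetric]) (auto intro!: monoI mult_left_mono)
  finally show ?thesis by (simp add: 1 lp_norm_infinity)
next
  case (2 r)
  have "(\<Sum>i<dim_vec v. cmod ((c \<cdot>\<^sub>v v) $ i) powr r) = cmod c powr r * (\<Sum>i<dim_vec v. cmod (v $ i) powr r)"
    by (simp add: norm_mult powr_mult sum_distrib_left)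
  then show ?thesis
    using 2 by (simp add: lp_norm_ereal powr_mult powr_powr sum_nonneg)
qed

lemma lp_norm_pos:
  assumes p: "1 \<le> p" and i: "i < dim_vec v" "v $ i \<noteq> 0"
  shows "0 < lp_norm p v"
  using p
proof (cases rule: ereal_ge_1_cases)
  case 1
  have "0 < cmod (v $ i)" using i by simp
  also have "\<dots> \<le> Max ((\<lambda>i. cmod (v $ i)) ` {..<dim_vec v})" using i by (intro Max_ge) auto
  finally show ?thesis by (simp add: 1 lp_norm_infinity)
next
  case (2 r)
  have "(\<Sum>i<dim_vec v. cmod (v $ i) powr r) > 0"
    using i by (intro sum_pos2[of _ i]) auto
  then show ?thesis using 2 by (simp add: lp_norm_ereal)
qed

lemma lp_opnorm_le:
  assumes p: "1 \<le> p" and A: "0 < dim_col A"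
    and bound: "\<And>v. v \<in> carrier_vec (dim_col A) \<Longrightarrow> lp_norm p v = 1 \<Longrightarrow> lp_norm p (A *\<^sub>v v) \<le> K"
  shows "lp_opnorm p A \<le> K"
proof -
  let ?e = "unit_vec (dim_col A) 0 :: complex Matrix.vec"
  let ?v = "of_real (1 / lp_norm p ?e) \<cdot>\<^sub>v ?e"
  have "0 < lp_norm p ?e" using p A by (intro lp_norm_pos[where i = 0]) auto
  then have "lp_norm p ?v = 1"
    using p A by (subst lp_norm_smult) (auto simp: norm_divide)
  then have "\<exists>v. v \<in> carrier_vec (dim_col A) \<and> lp_norm p v = 1"
    by (intro exI[of _ ?v]) auto
  then show ?thesis unfolding lp_opnorm_def
    using bound by (intro cSup_least) auto
qed

text \<open>The bound \<open>K\<close> serves only to make the supremum one of a bounded set; on unbounded sets of reals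
  \<open>Sup\<close> carries no information.\<close>

lemma lp_opnorm_ge:
  assumes bound: "\<And>v. v \<in> carrier_vec (dim_col A) \<Longrightarrow> lp_norm p v = 1 \<Longrightarrow> lp_norm p (A *\<^sub>v v) \<le> K"
    and v: "v \<in> carrier_vec (dim_col A)" "lp_norm p v = 1"
  shows "lp_norm p (A *\<^sub>v v) \<le> lp_opnorm p A"
  unfolding lp_opnorm_def using assms by (intro cSup_upper bdd_aboveI[of _ K]) auto

section \<open>Operator norms of circulant and Hankel matrices\<close>

lemma dim_circulant_mat [simp]:
  "dim_row (circulant_mat n \<alpha>) = n" "dim_col (circulant_mat n \<alpha>) = n"
  by (simp_all add: circulant_mat_def)

lemma circulant_mult_vec_index:
  assumes "v \<in> carrier_vec n" "i < n"
  shows "(circulant_mat n \<alpha> *\<^sub>v v) $ i = (\<Sum>j<n. \<alpha> (cyc_diff n i j) * v $ j)"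
  using assms by (simp add: circulant_mat_def cyc_diff_def scalar_prod_def atLeast0LessThan)

text \<open>Row \<open>i\<close> of the Hankel matrix is row \<open>- i\<close>, modulo \<open>n\<close>, of the circulant.\<close>

lemma lp_opnorm_hankel_eq_circulant:
  assumes n: "0 < n"
  shows "lp_opnorm p (hankel_mat n \<alpha>) = lp_opnorm p (circulant_mat n \<alpha>)"
proof -
  define \<pi> where "\<pi> i = cyc_diff n i 0" for i
  have \<pi>: "bij_betw \<pi> {..<n} {..<n}"
    by (rule bij_betw_byWitness[where f' = \<pi>]) (auto simp: \<pi>_def cyc_diff_cyc_diff cyc_diff_less n)
  have entry: "cyc_diff n (\<pi> i) j = (i + j) mod n" for i j
  proof -
    have "int (cyc_diff n (\<pi> i) j) = (int j - (int 0 - int i) mod int n) mod int n"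
      by (simp only: \<pi>_def int_cyc_diff n)
    also have "\<dots> = int ((i + j) mod n)"
      by (simp add: mod_diff_right_eq of_nat_mod add.commute)
    finally show ?thesis by (simp only: of_nat_eq_iff)
  qed
  have "lp_norm p (hankel_mat n \<alpha> *\<^sub>v v) = lp_norm p (circulant_mat n \<alpha> *\<^sub>v v)"
    if v: "v \<in> carrier_vec n" for v
  proof (rule lp_norm_reindex)
    show "bij_betw \<pi> {..<dim_vec (hankel_mat n \<alpha> *\<^sub>v v)} {..<dim_vec (circulant_mat n \<alpha> *\<^sub>v v)}"
      using \<pi> by (simp add: hankel_mat_def)
    fix i assume "i < dim_vec (hankel_mat n \<alpha> *\<^sub>v v)"
    then have i: "i < n" by (simp add: hankel_mat_def)
    have "(circulant_mat n \<alpha> *\<^sub>v v) $ \<pi> i = (\<Sum>j<n. \<alpha> (cyc_diff n (\<pi> i) j) * v $ j)"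
      using v by (intro circulant_mult_vec_index) (simp_all add: \<pi>_def cyc_diff_less n)
    then show "(hankel_mat n \<alpha> *\<^sub>v v) $ i = (circulant_mat n \<alpha> *\<^sub>v v) $ \<pi> i"
      using v i by (simp add: entry hankel_mat_def scalar_prod_def atLeast0LessThan)
  qed
  moreover have "dim_col (hankel_mat n \<alpha>) = n" by (simp add: hankel_mat_def)
  ultimately show ?thesis
    unfolding lp_opnorm_def dim_circulant_mat by (metis (no_types, lifting))
qed

text \<open>The bound of the Riesz--Thorin theorem at exponent \<open>p\<close>, when \<open>S\<close> bounds the operator norm at
  the exponents 1 and \<open>\<infinity>\<close>, and \<open>L\<close> bounds it at 2. The convention \<open>rpow 0 0 = 1\<close> makes it
  right at 1 and 2 for the zero matrix too; at \<open>\<infinity>\<close> the exponents are 1 and 0.\<close>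

definition interp_bound :: "real \<Rightarrow> real \<Rightarrow> ereal \<Rightarrow> real" where
  "interp_bound S L p =
     (if p = \<infinity> then S
      else let r = real_of_ereal p in
        if r < 2 then rpow S ((2 - r) / r) * rpow L (2 * (r - 1) / r)
        else rpow S ((r - 2) / r) * rpow L (2 / r))"

text \<open>At a finite \<open>p\<close> the exponents of the two factors add up to 1.\<close>

lemma interp_bound_diag:
  assumes p: "1 \<le> p" and S: "0 \<le> S"
  shows "interp_bound S S p = S"
proof -
  have *: "rpow S a * rpow S b = S" if "a + b = 1" for a b
    using that S by (auto simp: rpow_def simp flip: powr_add)
  show ?thesis
    using p
  proof (cases rule: ereal_ge_1_cases)
    case (2 r)
    have "(2 - r) / r + 2 * (r - 1) / r = 1" "(r - 2) / r + 2 / r = 1"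
      using \<open>1 \<le> r\<close> by (simp_all add: field_simps)
    then show ?thesis by (simp add: 2 interp_bound_def Let_def *)
  qed (simp add: interp_bound_def)
qed

text \<open>At the exponents 1, 2 and \<open>\<infinity>\<close> the bound is direct: column sums, the Fourier transform and row
  sums. At all others it is an interpolated one, from 1 and 2 below 2, and from 2 and \<open>\<infinity>\<close> above.\<close>

lemma circulant_unit_vec_le:
  fixes \<alpha> :: "nat \<Rightarrow> complex"
  assumes n: "0 < n" and p: "1 \<le> p"
    and L: "\<And>w. w ^ n = 1 \<Longrightarrow> cmod (\<Sum>k<n. \<alpha> k * w ^ k) \<le> L"
    and v: "v \<in> carrier_vec n" "lp_norm p v = 1"
  shows "lp_norm p (circulant_mat n \<alpha> *\<^sub>v v) \<le> interp_bound (\<Sum>k<n. cmod (\<alpha> k)) L p"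
proof -
  define S where "S = (\<Sum>k<n. cmod (\<alpha> k))"
  define u where "u = circulant_mat n \<alpha> *\<^sub>v v"
  have dim: "dim_vec u = n" "dim_vec v = n" using v by (simp_all add: u_def)
  have u: "u $ i = (\<Sum>j<n. \<alpha> (cyc_diff n i j) * v $ j)" if "i < n" for i
    unfolding u_def using v(1) that by (rule circulant_mult_vec_index)
  have S0: "0 \<le> S" by (auto simp: S_def intro: sum_nonneg)
  have L0: "0 \<le> L" using order_trans[OF norm_ge_zero L[of 1]] by simp
  have cols: "(\<Sum>i<n. cmod (\<alpha> (cyc_diff n i j))) = S" for j
    unfolding S_def by (rule sum_cyc_diff_left[OF n])
  have rows: "(\<Sum>j<n. cmod (\<alpha> (cyc_diff n i j))) = S" for i
    unfolding S_def by (rule sum_cyc_diff_right[OF n])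
  have "lp_norm p u \<le> interp_bound S L p"
    using p
  proof (cases rule: ereal_ge_1_cases)
    case 1
    have v1: "cmod (v $ j) \<le> 1" if "j < n" for j
    proof -
      have "cmod (v $ j) \<le> Max ((\<lambda>j. cmod (v $ j)) ` {..<n})" using that by (intro Max_ge) auto
      then show ?thesis using v(2) by (simp add: 1 lp_norm_infinity dim)
    qed
    have "cmod (u $ i) \<le> S" if "i < n" for i
    proof -
      have "cmod (u $ i) \<le> (\<Sum>j<n. cmod (\<alpha> (cyc_diff n i j)))"
        unfolding u[OF that] using v1
        by (intro sum_norm_le) (auto simp: norm_mult intro!: mult_left_le)
      then show ?thesis by (simp add: rows)
    qed
    then have "Max ((\<lambda>i. cmod (u $ i)) ` {..<n}) \<le> S"
      using n by (intro Max.boundedI) auto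
    then show ?thesis by (simp add: 1 interp_bound_def lp_norm_infinity dim)
  next
    case (2 r)
    have v1: "(\<Sum>j<n. cmod (v $ j) powr r) powr (1 / r) = 1"
      using v(2) by (simp add: 2 lp_norm_ereal dim)
    have norm_u: "lp_norm p u = (\<Sum>i<n. cmod (\<Sum>j<n. \<alpha> (cyc_diff n i j) * v $ j) powr r) powr (1 / r)"
      by (simp add: 2 lp_norm_ereal dim u)
    note l2 = circulant_bilinear_l2_bound[OF n L]
    consider "r = 1" | "1 < r" "r < 2" | "r = 2" | "2 < r" using \<open>1 \<le> r\<close> by linarith
    then show ?thesis
    proof cases
      case r: 1
      have v1': "(\<Sum>j<n. cmod (v $ j)) = 1" using v1 by (simp add: r sum_nonneg)
      have "lp_norm p u = (\<Sum>i<n. cmod (\<Sum>j<n. \<alpha> (cyc_diff n i j) * v $ j))"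
        by (simp add: norm_u r sum_nonneg)
      also have "\<dots> \<le> (\<Sum>i<n. \<Sum>j<n. cmod (\<alpha> (cyc_diff n i j)) * cmod (v $ j))"
        by (intro sum_mono sum_norm_le) (simp add: norm_mult)
      also have "\<dots> = (\<Sum>j<n. (\<Sum>i<n. cmod (\<alpha> (cyc_diff n i j))) * cmod (v $ j))"
        by (subst sum.swap) (simp add: sum_distrib_right)
      also have "\<dots> = S" by (simp add: cols v1' flip: sum_distrib_left)
      finally show ?thesis using S0 by (simp add: 2 r interp_bound_def rpow_def)
    next
      case r: 2
      have "lp_norm p u \<le> S powr ((2 - r) / r) * L powr (2 * (r - 1) / r) * (\<Sum>j<n. cmod (v $ j) powr r) powr (1 / r)"
        unfolding norm_u
        using r S0 L0 by (intro col_sum_interpolation l2) (simp_all add: cols)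
      then show ?thesis using r by (simp add: v1 2 interp_bound_def rpow_def)
    next
      case r: 3
      have v1': "(\<Sum>j<n. (cmod (v $ j))\<^sup>2) = 1" using v1 by (simp add: r sum_nonneg powr_half_sqrt)
      have "lp_norm p u = sqrt (\<Sum>i<n. (cmod (\<Sum>j<n. \<alpha> (cyc_diff n i j) * v $ j))\<^sup>2)"
        by (simp add: norm_u r sum_nonneg powr_half_sqrt)
      also have "\<dots> \<le> sqrt (L\<^sup>2 * (\<Sum>j<n. (cmod (v $ j))\<^sup>2))"
        by (intro real_sqrt_le_mono circulant_l2_bound n L)
      also have "\<dots> = L" using L0 by (simp add: v1')
      finally show ?thesis using L0 by (simp add: 2 r interp_bound_def rpow_def)
    next
      case r: 4
      have "lp_norm p u \<le> S powr ((r - 2) / r) * L powr (2 / r) * (\<Sum>j<n. cmod (v $ j) powr r) powr (1 / r)"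
        unfolding norm_u
        using r S0 L0 by (intro row_sum_interpolation l2) (simp_all add: rows)
      then show ?thesis using r by (simp add: v1 2 interp_bound_def rpow_def)
    qed
  qed
  then show ?thesis by (simp add: u_def S_def)
qed

lemma circulant_symbol_le_sum:
  fixes \<alpha> :: "nat \<Rightarrow> complex"
  assumes "w ^ n = 1"
  shows "cmod (\<Sum>k<n. \<alpha> k * w ^ k) \<le> (\<Sum>k<n. cmod (\<alpha> k))"
proof (cases "n = 0")
  case False
  then show ?thesis
    using norm_root_of_unity[OF assms]
    by (intro sum_norm_le) (simp add: norm_mult norm_power)
qed simp

text \<open>The symbol is at most the sum of the moduli, and interpolating between equal bounds changes nothing.
  So a single proof covers all exponents, with no separate appeal to Minkowski's inequality.\<close>

lemma circulant_unit_vec_le_sum: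
  fixes \<alpha> :: "nat \<Rightarrow> complex"
  assumes n: "0 < n" and p: "1 \<le> p" and v: "v \<in> carrier_vec n" "lp_norm p v = 1"
  shows "lp_norm p (circulant_mat n \<alpha> *\<^sub>v v) \<le> (\<Sum>k<n. cmod (\<alpha> k))"
  using circulant_unit_vec_le[OF n p circulant_symbol_le_sum v]
  by (simp add: interp_bound_diag[OF p] sum_nonneg)

lemma circulant_opnorm_le_sum:
  assumes n: "0 < n" and p: "1 \<le> p"
  shows "lp_opnorm p (circulant_mat n \<alpha>) \<le> (\<Sum>k<n. cmod (\<alpha> k))"
  using n p by (intro lp_opnorm_le) (simp_all add: circulant_unit_vec_le_sum)

lemma circulant_opnorm_ge:
  assumes n: "0 < n" and p: "1 \<le> p" and v: "v \<in> carrier_vec n" "lp_norm p v = 1"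
  shows "lp_norm p (circulant_mat n \<alpha> *\<^sub>v v) \<le> lp_opnorm p (circulant_mat n \<alpha>)"
  using circulant_unit_vec_le_sum[OF n p] v by (intro lp_opnorm_ge) auto

lemma circulant_opnorm_le:
  fixes \<alpha> :: "nat \<Rightarrow> complex"
  assumes n: "0 < n" and p: "1 \<le> p"
    and L: "\<And>w. w ^ n = 1 \<Longrightarrow> cmod (\<Sum>k<n. \<alpha> k * w ^ k) \<le> L"
  shows "lp_opnorm p (circulant_mat n \<alpha>) \<le> interp_bound (\<Sum>k<n. cmod (\<alpha> k)) L p"
  using n p by (intro lp_opnorm_le) (simp_all add: circulant_unit_vec_le L)

text \<open>The vector of powers \<open>w ^ j\<close> is an eigenvector whose eigenvalue is the symbol at \<open>w\<close>; every
  operator norm dominates the modulus of an eigenvalue.\<close>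

lemma circulant_symbol_le_opnorm:
  fixes \<alpha> :: "nat \<Rightarrow> complex"
  assumes n: "0 < n" and p: "1 \<le> p" and w: "w ^ n = 1"
  shows "cmod (\<Sum>k<n. \<alpha> k * w ^ k) \<le> lp_opnorm p (circulant_mat n \<alpha>)"
proof -
  define \<mu> where "\<mu> = (\<Sum>k<n. \<alpha> k * w ^ k)"
  define e where "e = Matrix.vec n (\<lambda>j. w ^ j)"
  have e: "0 < lp_norm p e"
    using n by (intro lp_norm_pos[OF p, where i = 0]) (auto simp: e_def)
  define v where "v = of_real (1 / lp_norm p e) \<cdot>\<^sub>v e"
  have v: "v \<in> carrier_vec n" by (simp add: v_def e_def)
  have v1: "lp_norm p v = 1"
    unfolding v_def using e p n by (subst lp_norm_smult) (auto simp: norm_divide e_def)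
  have "circulant_mat n \<alpha> *\<^sub>v v = \<mu> \<cdot>\<^sub>v v"
  proof (rule eq_vecI)
    fix i assume "i < dim_vec (\<mu> \<cdot>\<^sub>v v)"
    then have i: "i < n" using v by simp
    let ?c = "of_real (1 / lp_norm p e) :: complex"
    have "(circulant_mat n \<alpha> *\<^sub>v v) $ i = (\<Sum>j<n. \<alpha> (cyc_diff n i j) * (?c * w ^ j))"
      unfolding circulant_mult_vec_index[OF v i] by (intro sum.cong) (simp_all add: v_def e_def)
    also have "\<dots> = (\<Sum>j<n. (?c * w ^ i) * (\<alpha> (cyc_diff n i j) * w ^ cyc_diff n i j))"
    proof (rule sum.cong[OF refl])
      fix j
      show "\<alpha> (cyc_diff n i j) * (?c * w ^ j) = (?c * w ^ i) * (\<alpha> (cyc_diff n i j) * w ^ cyc_diff n i j)"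
        unfolding power_cyc_diff[OF n w, of i j, symmetric] by (simp only: mult_ac)
    qed
    also have "\<dots> = (?c * w ^ i) * \<mu>"
      unfolding \<mu>_def sum_distrib_left[symmetric]
      using sum_cyc_diff_right[OF n, of "\<lambda>k. \<alpha> k * w ^ k"] by simp
    also have "\<dots> = (\<mu> \<cdot>\<^sub>v v) $ i" using i by (simp add: v_def e_def)
    finally show "(circulant_mat n \<alpha> *\<^sub>v v) $ i = (\<mu> \<cdot>\<^sub>v v) $ i" .
  qed (use v in simp)
  moreover have "lp_norm p (\<mu> \<cdot>\<^sub>v v) = cmod \<mu>"
    using v v1 n p by (simp add: lp_norm_smult)
  ultimately show ?thesis
    using circulant_opnorm_ge[OF n p v v1, of \<alpha>] by (simp add: \<mu>_def)
qed

text \<open>The first standard basis vector attains the column sum.\<close>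

lemma circulant_opnorm_1:
  assumes n: "0 < n"
  shows "lp_opnorm 1 (circulant_mat n \<alpha>) = (\<Sum>k<n. cmod (\<alpha> k))"
proof (rule antisym)
  have norm1: "lp_norm 1 v = (\<Sum>i<dim_vec v. cmod (v $ i))" for v
    using lp_norm_ereal[of 1 v] by (simp add: one_ereal_def sum_nonneg)
  let ?e = "unit_vec n 0 :: complex Matrix.vec"
  have "lp_norm 1 ?e = 1"
    using n by (simp add: norm1 unit_vec_def if_distrib sum.delta cong: if_cong)
  moreover have "lp_norm 1 (circulant_mat n \<alpha> *\<^sub>v ?e) = (\<Sum>k<n. cmod (\<alpha> k))"
  proof -
    have "(circulant_mat n \<alpha> *\<^sub>v ?e) $ i = \<alpha> (cyc_diff n i 0)" if "i < n" for i
      using that n by (subst circulant_mult_vec_index) (auto simp: unit_vec_def if_distrib sum.delta cong: if_cong)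
    then show ?thesis
      using sum_cyc_diff_left[OF n, of "\<lambda>k. cmod (\<alpha> k)" 0] by (simp add: norm1)
  qed
  ultimately show "(\<Sum>k<n. cmod (\<alpha> k)) \<le> lp_opnorm 1 (circulant_mat n \<alpha>)"
    using circulant_opnorm_ge[OF n _ unit_vec_carrier, of 1 0 \<alpha>] by simp
qed (use n in \<open>simp add: circulant_opnorm_le_sum\<close>)

text \<open>The vector of conjugate phases of row 0 attains the row sum. Where an entry of the row vanishes
  the phase is taken to be 1, so that the vector has norm 1 even for the zero matrix.\<close>

lemma circulant_opnorm_infinity:
  assumes n: "0 < n"
  shows "lp_opnorm \<infinity> (circulant_mat n \<alpha>) = (\<Sum>k<n. cmod (\<alpha> k))"
proof (rule antisym)
  define s where "s j = (if \<alpha> j = 0 then 1 else cnj (sgn (\<alpha> j)))" for j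
  define v where "v = Matrix.vec n s"
  have s1: "cmod (s j) = 1" for j by (simp add: s_def norm_sgn)
  have v: "v \<in> carrier_vec n" by (simp add: v_def)
  have "(\<lambda>j. cmod (v $ j)) ` {..<n} = {1}" using n by (auto simp: v_def s1 image_def)
  then have v1: "lp_norm \<infinity> v = 1" by (simp add: lp_norm_infinity v_def)
  have "\<alpha> j * s j = of_real (cmod (\<alpha> j))" for j
    by (simp add: s_def sgn_eq complex_norm_square [symmetric] power2_eq_square)
  moreover have "cyc_diff n 0 j = j" if "j < n" for j using cyc_diff_add_mod[OF that, of 0] that by simp
  ultimately have "(circulant_mat n \<alpha> *\<^sub>v v) $ 0 = of_real (\<Sum>k<n. cmod (\<alpha> k))"
    unfolding circulant_mult_vec_index[OF v n] by (simp add: v_def)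
  then have "(\<Sum>k<n. cmod (\<alpha> k)) = cmod ((circulant_mat n \<alpha> *\<^sub>v v) $ 0)"
    by (simp only: norm_of_real) (simp add: sum_nonneg)
  also have "\<dots> \<le> lp_norm \<infinity> (circulant_mat n \<alpha> *\<^sub>v v)"
    unfolding lp_norm_infinity using n by (intro Max_ge) auto
  also have "\<dots> \<le> lp_opnorm \<infinity> (circulant_mat n \<alpha>)"
    by (rule circulant_opnorm_ge[OF n _ v v1]) simp
  finally show "(\<Sum>k<n. cmod (\<alpha> k)) \<le> lp_opnorm \<infinity> (circulant_mat n \<alpha>)" .
qed (use n in \<open>simp add: circulant_opnorm_le_sum\<close>)

text \<open>At the exponent 2 the general upper bound is the maximum of the symbol, and the eigenvalues
  show that it is attained.\<close>

lemma circulant_opnorm_2: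
  fixes \<alpha> :: "nat \<Rightarrow> complex"
  assumes n: "0 < n"
  shows "lp_opnorm 2 (circulant_mat n \<alpha>) = Max {cmod (\<Sum>k<n. \<alpha> k * w ^ k) | w. w ^ n = 1}"
    (is "_ = Max ?M")
proof -
  have fin: "finite ?M" using finite_roots_unity[of n, where 'a = complex] n by simp
  have ne: "?M \<noteq> {}" using power_one by blast
  have two: "(2 :: ereal) = ereal 2" by simp
  have L: "cmod (\<Sum>k<n. \<alpha> k * w ^ k) \<le> Max ?M" if "w ^ n = 1" for w
    using that fin by (intro Max_ge) auto
  then have L0: "0 \<le> Max ?M" using order_trans[OF norm_ge_zero L[of 1]] by simp
  have "lp_opnorm 2 (circulant_mat n \<alpha>) \<le> interp_bound (\<Sum>k<n. cmod (\<alpha> k)) (Max ?M) 2"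
    using n L by (intro circulant_opnorm_le) (auto simp: two)
  also have "\<dots> = Max ?M" unfolding two using L0 by (simp add: interp_bound_def rpow_def)
  finally have "lp_opnorm 2 (circulant_mat n \<alpha>) \<le> Max ?M" .
  moreover have "Max ?M \<le> lp_opnorm 2 (circulant_mat n \<alpha>)"
  proof (rule Max.boundedI[OF fin ne])
    show "x \<le> lp_opnorm 2 (circulant_mat n \<alpha>)" if "x \<in> ?M" for x
      using that circulant_symbol_le_opnorm[OF n, of 2] by (auto simp: two)
  qed
  ultimately show ?thesis by (rule antisym)
qed

lemma circulant_opnorm_2_attained:
  fixes \<alpha> :: "nat \<Rightarrow> complex"
  assumes n: "0 < n"
  obtains w where "w ^ n = 1" "lp_opnorm 2 (circulant_mat n \<alpha>) = cmod (\<Sum>k<n. \<alpha> k * w ^ k)"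
proof -
  let ?M = "{cmod (\<Sum>k<n. \<alpha> k * w ^ k) | w. w ^ n = 1}"
  have "finite ?M" using finite_roots_unity[of n, where 'a = complex] n by simp
  moreover have "?M \<noteq> {}" using power_one by blast
  ultimately have "Max ?M \<in> ?M" by (rule Max_in)
  then obtain w where "w ^ n = 1" "Max ?M = cmod (\<Sum>k<n. \<alpha> k * w ^ k)" by auto
  then show ?thesis by (intro that) (simp_all only: circulant_opnorm_2[OF n])
qed

lemma circulant_symbol_le_opnorm_2:
  fixes \<alpha> :: "nat \<Rightarrow> complex"
  assumes "0 < n" "w ^ n = 1"
  shows "cmod (\<Sum>k<n. \<alpha> k * w ^ k) \<le> lp_opnorm 2 (circulant_mat n \<alpha>)"
  using assms by (intro circulant_symbol_le_opnorm) auto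

lemma circulant_opnorm_2_le:
  assumes n: "0 < n" and p: "1 \<le> p"
  shows "lp_opnorm 2 (circulant_mat n \<alpha>) \<le> lp_opnorm p (circulant_mat n \<alpha>)"
  by (metis circulant_opnorm_2_attained[OF n] circulant_symbol_le_opnorm[OF n p])

text \<open>The symbol reaches its trivial bound at \<open>w\<close> exactly when the terms \<open>\<alpha> k * w ^ k\<close> share a phase \<open>\<beta>\<close>; then
  \<open>\<omega>\<close> is the inverse of \<open>w\<close>.\<close>

lemma phase_condition_iff:
  fixes \<alpha> :: "nat \<Rightarrow> complex"
  assumes n: "0 < n"
  shows "(\<exists>w. w ^ n = 1 \<and> cmod (\<Sum>k<n. \<alpha> k * w ^ k) = (\<Sum>k<n. cmod (\<alpha> k))) \<longleftrightarrow>
    (\<exists>\<beta> \<omega>. cmod \<beta> = 1 \<and> \<omega> ^ n = 1 \<and> (\<forall>i<n. \<alpha> i = \<beta> * \<omega> ^ i * of_real (cmod (\<alpha> i))))"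
    (is "?L \<longleftrightarrow> ?R")
proof -
  have inv: "w ^ k * cnj w ^ k = 1" "cnj w ^ n = 1" if "w ^ n = 1" for w :: complex and k
  proof -
    show "w ^ k * cnj w ^ k = 1"
      using norm_root_of_unity[OF that n]
      by (simp flip: power_mult_distrib add: complex_norm_square [symmetric])
    show "cnj w ^ n = 1" using that by (simp flip: complex_cnj_power)
  qed
  show ?thesis
  proof
    assume ?L
    then obtain w where w: "w ^ n = 1" and eq: "cmod (\<Sum>k<n. \<alpha> k * w ^ k) = (\<Sum>k<n. cmod (\<alpha> k))"
      by blast
    have nw: "cmod (\<alpha> k * w ^ k) = cmod (\<alpha> k)" for k
      using norm_root_of_unity[OF w n] by (simp add: norm_mult norm_power)
    have "cmod (\<Sum>k<n. \<alpha> k * w ^ k) = (\<Sum>k<n. cmod (\<alpha> k * w ^ k))"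
      using eq by (simp only: nw)
    then obtain b where b: "cmod b = 1"
      and ph: "\<And>k. k \<in> {..<n} \<Longrightarrow> \<alpha> k * w ^ k = b * of_real (cmod (\<alpha> k * w ^ k))"
      by (rule triangle_equality_phase[rotated]) auto
    have "\<alpha> k = b * cnj w ^ k * of_real (cmod (\<alpha> k))" if "k < n" for k
    proof -
      have "\<alpha> k = (\<alpha> k * w ^ k) * cnj w ^ k" using inv(1)[OF w, of k] by (simp add: mult.assoc)
      also have "\<dots> = b * of_real (cmod (\<alpha> k)) * cnj w ^ k"
        using ph[of k] that by (simp only: nw lessThan_iff)
      finally show ?thesis by (simp only: mult_ac)
    qed
    then show ?R using b inv(2)[OF w] by blast
  next
    assume ?R
    then obtain b w where b: "cmod b = 1" and w: "w ^ n = 1"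
      and ph: "\<And>k. k < n \<Longrightarrow> \<alpha> k = b * w ^ k * of_real (cmod (\<alpha> k))" by blast
    have "\<alpha> k * cnj w ^ k = b * of_real (cmod (\<alpha> k))" if "k < n" for k
    proof -
      have "\<alpha> k * cnj w ^ k = b * w ^ k * of_real (cmod (\<alpha> k)) * cnj w ^ k"
        using ph[OF that] by simp
      also have "\<dots> = b * of_real (cmod (\<alpha> k)) * (w ^ k * cnj w ^ k)" by (simp only: mult_ac)
      finally show ?thesis by (simp add: inv(1)[OF w])
    qed
    then have "(\<Sum>k<n. \<alpha> k * cnj w ^ k) = b * of_real (\<Sum>k<n. cmod (\<alpha> k))"
      by (simp add: sum_distrib_left)
    then have "cmod (\<Sum>k<n. \<alpha> k * cnj w ^ k) = (\<Sum>k<n. cmod (\<alpha> k))"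
      by (simp only: norm_mult b norm_of_real) (simp add: sum_nonneg)
    then show ?L using inv(2)[OF w] by blast
  qed
qed

text \<open>An eigenvalue of the circulant then equals the upper bound valid for every exponent.\<close>

lemma lp_opnorm_hankel_of_phase:
  fixes \<alpha> :: "nat \<Rightarrow> complex"
  assumes n: "0 < n" and p: "1 \<le> p"
    and phase: "\<exists>\<beta> \<omega>. cmod \<beta> = 1 \<and> \<omega> ^ n = 1 \<and> (\<forall>i<n. \<alpha> i = \<beta> * \<omega> ^ i * of_real (cmod (\<alpha> i)))"
  shows "lp_opnorm p (hankel_mat n \<alpha>) = (\<Sum>k<n. cmod (\<alpha> k))"
proof (rule antisym)
  show "lp_opnorm p (hankel_mat n \<alpha>) \<le> (\<Sum>k<n. cmod (\<alpha> k))"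
    unfolding lp_opnorm_hankel_eq_circulant[OF n] by (rule circulant_opnorm_le_sum[OF n p])
  obtain w where "w ^ n = 1" "cmod (\<Sum>k<n. \<alpha> k * w ^ k) = (\<Sum>k<n. cmod (\<alpha> k))"
    using phase unfolding phase_condition_iff[OF n, symmetric] by blast
  then show "(\<Sum>k<n. cmod (\<alpha> k)) \<le> lp_opnorm p (hankel_mat n \<alpha>)"
    unfolding lp_opnorm_hankel_eq_circulant[OF n]
    using circulant_symbol_le_opnorm[OF n p, of w \<alpha>] by simp
qed

text \<open>Since the norms at the exponents 1 and \<open>\<infinity>\<close> agree, membership in \<open>LA n\<close> says that the operator norm
  does not depend on the exponent. The exponent 2 alone already forces the phase condition, because there the norm
  is a value of the symbol.\<close>

lemma hankel_in_LA_iff: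
  fixes \<alpha> :: "nat \<Rightarrow> complex"
  assumes n: "0 < n"
  shows "hankel_mat n \<alpha> \<in> LA n \<longleftrightarrow>
    (\<exists>\<beta> \<omega>. cmod \<beta> = 1 \<and> \<omega> ^ n = 1 \<and> (\<forall>i<n. \<alpha> i = \<beta> * \<omega> ^ i * of_real (cmod (\<alpha> i))))"
    (is "_ \<longleftrightarrow> ?R")
proof -
  define S where "S = (\<Sum>k<n. cmod (\<alpha> k))"
  have S0: "0 \<le> S" by (simp add: S_def sum_nonneg)
  have rp: "rpow S a * rpow S (1 - a) = S" for a
    using S0 by (auto simp: rpow_def simp flip: powr_add)
  have "hankel_mat n \<alpha> \<in> LA n \<longleftrightarrow> (\<forall>p. 1 \<le> p \<longrightarrow> lp_opnorm p (hankel_mat n \<alpha>) = S)"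
  proof -
    have "hankel_mat n \<alpha> \<in> carrier_mat n n" by (simp add: hankel_mat_def)
    then show ?thesis
      by (simp add: LA_def lp_opnorm_hankel_eq_circulant[OF n] circulant_opnorm_1[OF n]
          circulant_opnorm_infinity[OF n] rp flip: S_def)
  qed
  also have "\<dots> \<longleftrightarrow> ?R"
  proof
    assume "\<forall>p. 1 \<le> p \<longrightarrow> lp_opnorm p (hankel_mat n \<alpha>) = S"
    then have "lp_opnorm 2 (circulant_mat n \<alpha>) = S"
      by (simp add: lp_opnorm_hankel_eq_circulant[OF n])
    moreover obtain w where "w ^ n = 1" "lp_opnorm 2 (circulant_mat n \<alpha>) = cmod (\<Sum>k<n. \<alpha> k * w ^ k)"
      by (rule circulant_opnorm_2_attained[OF n])
    ultimately show ?R unfolding phase_condition_iff[OF n, symmetric] S_def by auto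
  next
    assume ?R
    then show "\<forall>p. 1 \<le> p \<longrightarrow> lp_opnorm p (hankel_mat n \<alpha>) = S"
      unfolding S_def using lp_opnorm_hankel_of_phase[OF n] by blast
  qed
  finally show ?thesis .
qed

theorem corollary3p7:
  fixes n :: nat
  assumes "n \<ge> 1"
  shows
    "(\<forall>\<alpha> :: nat \<Rightarrow> complex. \<forall>B. B = hankel_mat n \<alpha> \<longrightarrow>
        (B \<in> LA n \<longleftrightarrow>
          (\<exists>\<beta> \<omega> :: complex. cmod \<beta> = 1 \<and> \<omega> ^ n = 1 \<and>
             (\<forall>i<n. \<alpha> i = \<beta> * \<omega> ^ i * complex_of_real (cmod (\<alpha> i))))) \<and>
        (B \<in> LA n \<longrightarrow>
          (\<forall>p :: ereal. 1 \<le> p \<longrightarrow> lp_opnorm p B = (\<Sum>i<n. cmod (\<alpha> i))))) \<and>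
     (\<forall>\<alpha> :: nat \<Rightarrow> real. \<forall>A. A = circulant_mat n (\<lambda>i. complex_of_real (\<alpha> i)) \<longrightarrow>
        lp_opnorm 2 A =
          Max {cmod (\<Sum>i<n. complex_of_real (\<alpha> i) * \<omega> ^ i) | \<omega> :: complex. \<omega> ^ n = 1} \<and>
        (\<forall>p :: ereal. 1 \<le> p \<longrightarrow> lp_opnorm 2 A \<le> lp_opnorm p A) \<and>
        (\<forall>p :: real. 1 \<le> p \<and> p < 2 \<longrightarrow>
           lp_opnorm (ereal p) A
             \<le> rpow (\<Sum>i<n. \<bar>\<alpha> i\<bar>) ((2 - p) / p) * rpow (lp_opnorm 2 A) (2 * (p - 1) / p)) \<and>
        (\<forall>p :: real. 2 \<le> p \<longrightarrow>
           lp_opnorm (ereal p) A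
             \<le> rpow (\<Sum>i<n. \<bar>\<alpha> i\<bar>) ((p - 2) / p) * rpow (lp_opnorm 2 A) (2 / p)) \<and>
        lp_opnorm \<infinity> A \<le> rpow (\<Sum>i<n. \<bar>\<alpha> i\<bar>) 1 * rpow (lp_opnorm 2 A) 0)"
proof -
  have n: "0 < n" using assms by simp
  have bound: "lp_opnorm p (circulant_mat n (\<lambda>i. complex_of_real (\<alpha> i)))
      \<le> interp_bound (\<Sum>i<n. \<bar>\<alpha> i\<bar>) (lp_opnorm 2 (circulant_mat n (\<lambda>i. complex_of_real (\<alpha> i)))) p"
    if "1 \<le> p" for p and \<alpha> :: "nat \<Rightarrow> real"
    using circulant_opnorm_le[OF n that circulant_symbol_le_opnorm_2[OF n], of "\<lambda>i. complex_of_real (\<alpha> i)"]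
    by simp
  show ?thesis
  proof (intro conjI allI impI; (elim conjE)?; hypsubst)
    fix \<alpha> :: "nat \<Rightarrow> complex" and p :: ereal
    show "hankel_mat n \<alpha> \<in> LA n \<longleftrightarrow>
        (\<exists>\<beta> \<omega>. cmod \<beta> = 1 \<and> \<omega> ^ n = 1 \<and> (\<forall>i<n. \<alpha> i = \<beta> * \<omega> ^ i * complex_of_real (cmod (\<alpha> i))))"
      by (rule hankel_in_LA_iff[OF n])
    assume "hankel_mat n \<alpha> \<in> LA n" "1 \<le> p"
    then show "lp_opnorm p (hankel_mat n \<alpha>) = (\<Sum>i<n. cmod (\<alpha> i))"
      unfolding hankel_in_LA_iff[OF n] by (intro lp_opnorm_hankel_of_phase[OF n])
  next
    fix \<alpha> :: "nat \<Rightarrow> real"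
    let ?A = "circulant_mat n (\<lambda>i. complex_of_real (\<alpha> i))"
    show "lp_opnorm 2 ?A = Max {cmod (\<Sum>i<n. complex_of_real (\<alpha> i) * \<omega> ^ i) | \<omega>. \<omega> ^ n = 1}"
      by (rule circulant_opnorm_2[OF n])
    show "lp_opnorm 2 ?A \<le> lp_opnorm p ?A" if "1 \<le> p" for p
      by (rule circulant_opnorm_2_le[OF n that])
    show "lp_opnorm (ereal p) ?A
        \<le> rpow (\<Sum>i<n. \<bar>\<alpha> i\<bar>) ((2 - p) / p) * rpow (lp_opnorm 2 ?A) (2 * (p - 1) / p)"
      if "1 \<le> p" "p < 2" for p :: real
      using bound[of "ereal p" \<alpha>] that by (simp add: interp_bound_def)
    show "lp_opnorm (ereal p) ?A
        \<le> rpow (\<Sum>i<n. \<bar>\<alpha> i\<bar>) ((p - 2) / p) * rpow (lp_opnorm 2 ?A) (2 / p)"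
      if "2 \<le> p" for p :: real
      using bound[of "ereal p" \<alpha>] that by (simp add: interp_bound_def)
    show "lp_opnorm \<infinity> ?A \<le> rpow (\<Sum>i<n. \<bar>\<alpha> i\<bar>) 1 * rpow (lp_opnorm 2 ?A) 0"
      using bound[of \<infinity> \<alpha>] by (simp add: interp_bound_def rpow_def sum_nonneg)
  qed
qed

end
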